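(* Consider the Curie-Weiss model with $h=0$ and $0<\beta<1$, i.e. the probability measures $$\mu_N(\sigma)=\frac1{Z_N}\exp\Big(\frac{\beta}{2N}\sum_{i,j=1}^N\sigma_i\sigma_j\Big),\qquad \sigma\in\{-1,+1\}^N,$$ with $Z_N$ the normalizing constant. Let $\tilde\xi\sim\mathcal N\big(0,\frac{\beta}{1-\beta}\big)$, let $0<\delta<\frac16$, and let $\xi=\xi_N=\tilde\xi\,\mathbf 1\{|\tilde\xi|\le N^\delta\}$. Define $$\nu_N(\sigma)=2^{-N}\,\mathbb E_\xi\Big[\prod_{i=1}^N\Big(1+\sigma_i\frac{\xi}{\sqrt N}\Big)\Big],\qquad\sigma\in\{-1,+1\}^N.$$ Then, as $N\to\infty$, $$H(\mu_N|\nu_N)\to 0\qquad\text{as well as}\qquad H(\nu_N|\mu_N)\to 0 .$$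
   Context: Relative entropy of probability measures: $H(\varrho|\pi)=\int\log\frac{d\varrho}{d\pi}\,d\varrho$ if $\varrho\ll\pi$, and $+\infty$ otherwise. $\mathbb E_\xi$ denotes expectation with respect to $\xi$. *)

theory Defs
  imports "HOL-Probability.Probability"
begin

(* For probability measures on a common measurable space. Since the negative part of
   log (d rho / d pi) is always rho-integrable, a failure of integrability means that the
   integral is +infinity, whereas the Bochner integral would silently return 0. The library's
   KL_divergence takes the reference measure first; base exp 1 gives the natural logarithm. *)
definition relative_entropy :: "'a measure \<Rightarrow> 'a measure \<Rightarrow> ereal" where
  "relative_entropy \<rho> \<pi> =
     (if absolutely_continuous \<pi> \<rho> \<and> integrable \<rho> (entropy_density (exp 1) \<pi> \<rho>)
      then ereal (KL_divergence (exp 1) \<pi> \<rho>) else \<infinity>)"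

definition spin_configs :: "nat \<Rightarrow> (nat \<Rightarrow> real) set" where
  "spin_configs N = {1..N} \<rightarrow>\<^sub>E {-1, 1}"

definition cw_weight :: "real \<Rightarrow> nat \<Rightarrow> (nat \<Rightarrow> real) \<Rightarrow> real" where
  "cw_weight \<beta> N \<sigma> = exp (\<beta> / (2 * real N) * (\<Sum>i=1..N. \<Sum>j=1..N. \<sigma> i * \<sigma> j))"

definition cw_partition_function :: "real \<Rightarrow> nat \<Rightarrow> real" where
  "cw_partition_function \<beta> N = (\<Sum>\<sigma>\<in>spin_configs N. cw_weight \<beta> N \<sigma>)"

definition curie_weiss :: "real \<Rightarrow> nat \<Rightarrow> (nat \<Rightarrow> real) measure" where
  "curie_weiss \<beta> N =
     point_measure (spin_configs N) (\<lambda>\<sigma>. ennreal (cw_weight \<beta> N \<sigma> / cw_partition_function \<beta> N))"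

definition truncated_rv :: "('w \<Rightarrow> real) \<Rightarrow> real \<Rightarrow> nat \<Rightarrow> 'w \<Rightarrow> real" where
  "truncated_rv X \<delta> N \<omega> = X \<omega> * indicator {w. \<bar>X w\<bar> \<le> real N powr \<delta>} \<omega>"

(* The random variable Y on the probability space M plays the role of xi_N. If |Y| <= sqrt N
   almost surely, the mass function is nonnegative, so ennreal does not truncate it, and it
   sums to 1. *)
definition spin_mixture :: "'w measure \<Rightarrow> ('w \<Rightarrow> real) \<Rightarrow> nat \<Rightarrow> (nat \<Rightarrow> real) measure" where
  "spin_mixture M Y N =
     point_measure (spin_configs N)
       (\<lambda>\<sigma>. ennreal ((1 / 2 ^ N) * (\<integral>\<omega>. (\<Prod>i=1..N. 1 + \<sigma> i * (Y \<omega> / sqrt (real N))) \<partial>M)))"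

end

theory Submission
  imports Defs "HOL-Real_Asymp.Real_Asymp"
begin

text \<open>
  Let \<open>x = (\<sigma>\<^sub>1 + \<dots> + \<sigma>\<^sub>N) / \<surd>N\<close>, \<open>m = N\<^sup>\<delta>\<close> and \<open>\<epsilon> = m\<^sup>3 / \<surd>N\<close>, which tends to 0 because \<open>\<delta> < 1/6\<close>.
  Since \<open>ln (1 + y) = y - y\<^sup>2/2 + O(y\<^sup>3)\<close>, the product \<open>\<Prod>(1 + \<sigma>\<^sub>i t/\<surd>N)\<close> agrees with
  \<open>exp (x t - t\<^sup>2/2)\<close> up to a factor \<open>exp (\<plusminus>\<epsilon>)\<close>, uniformly in \<open>\<sigma>\<close> and \<open>|t| \<le> m\<close>. Tilting the
  Gaussian law \<open>N(0, \<beta>/(1-\<beta>))\<close> by \<open>exp (x t - t\<^sup>2/2)\<close> produces the total mass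
  \<open>sqrt (1-\<beta>) exp (\<beta> x\<^sup>2/2)\<close> times the law \<open>N(\<beta>x, \<beta>)\<close>, so without truncation \<open>\<nu>\<^sub>N\<close> would be
  proportional to \<open>\<mu>\<^sub>N\<close>. The truncation adds at most \<open>O(1/m\<^sup>2)\<close>, whence \<open>\<nu>\<^sub>N \<le> (1 + o(1)) \<mu>\<^sub>N\<close>
  pointwise; summing this bound also identifies the limit of \<open>Z\<^sub>N / 2\<^sup>N\<close>. Conversely, by
  Chebyshev's inequality \<open>\<mu>\<^sub>N \<le> (1 + o(1)) \<nu>\<^sub>N\<close> where \<open>x\<^sup>2 \<le> m\<close>, while elsewhere
  \<open>ln (\<mu>\<^sub>N/\<nu>\<^sub>N) \<le> const + x\<^sup>2\<close>, and this region contributes \<open>O(1/m)\<close> because \<open>\<mu>\<^sub>N\<close> has uniformly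
  bounded moments \<open>exp (\<eta> x\<^sup>2/2)\<close> for \<open>\<beta> + \<eta> < 1\<close>.
\<close>

section \<open>Elementary inequalities for logarithm, exponential and cosh\<close>

text \<open>The error \<open>h\<close> has derivative \<open>z\<^sup>2 / (1 + z)\<close>, which lies
  between 0 and \<open>2 * z\<^sup>2\<close> for z \<ge> -1/2. Hence both \<open>h\<close> and z^3 -
  h are nondecreasing there, and both vanish at 0.\<close>

lemma abs_ln_one_plus_minus_quadratic_le:
  fixes y :: real
  assumes "\<bar>y\<bar> \<le> 1 / 2"
  shows "\<bar>ln (1 + y) - (y - y\<^sup>2 / 2)\<bar> \<le> \<bar>y\<bar> ^ 3"
proof -
  define h where "h = (\<lambda>z::real. ln (1 + z) - (z - z\<^sup>2 / 2))"
  define k where "k = (\<lambda>z::real. z ^ 3 - h z)"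
  have dh: "(h has_real_derivative z\<^sup>2 / (1 + z)) (at z)" if "-(1/2) \<le> z" for z
    unfolding h_def using that
    by (auto intro!: derivative_eq_intros simp: field_simps power2_eq_square)
  have dk: "(k has_real_derivative 3 * z\<^sup>2 - z\<^sup>2 / (1 + z)) (at z)" if "-(1/2) \<le> z" for z
    unfolding k_def using dh[OF that] by (auto intro!: derivative_eq_intros)
  have nonneg: "0 \<le> z\<^sup>2 / (1 + z)" "0 \<le> 3 * z\<^sup>2 - z\<^sup>2 / (1 + z)" if "-(1/2) \<le> z" for z :: real
  proof -
    have "z\<^sup>2 / (1 + z) \<le> z\<^sup>2 / (1/2)" using that by (intro divide_left_mono) auto
    hence "z\<^sup>2 / (1 + z) \<le> 2 * z\<^sup>2" by simp
    thus "0 \<le> 3 * z\<^sup>2 - z\<^sup>2 / (1 + z)"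
      using zero_le_power2[of z] by linarith
    show "0 \<le> z\<^sup>2 / (1 + z)" using that by simp
  qed
  have mono: "h a \<le> h b" "k a \<le> k b" if "-(1/2) \<le> a" "a \<le> b" for a b
    by (rule DERIV_nonneg_imp_nondecreasing[OF that(2)], rule exI, rule conjI[OF dh nonneg(1)],
        use that in linarith, use that in linarith)
       (rule DERIV_nonneg_imp_nondecreasing[OF that(2)], rule exI, rule conjI[OF dk nonneg(2)],
        use that in linarith, use that in linarith)
  have zero: "h 0 = 0" "k 0 = 0" by (simp_all add: h_def k_def)
  show ?thesis
  proof (cases "0 \<le> y")
    case True
    thus ?thesis using mono[of 0 y] zero by (simp add: h_def k_def)
  next
    case False
    hence "\<bar>y\<bar> ^ 3 = - (y ^ 3)" by (simp add: abs_if)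
    thus ?thesis using mono[of y 0] zero False assms by (simp add: h_def k_def)
  qed
qed

lemma ln_divide_le_of_le_exp:
  fixes p q B :: real
  assumes "0 < p" "0 < q" "p \<le> exp B * q"
  shows "ln (p / q) \<le> B"
proof -
  have "ln p \<le> ln (exp B * q)" using assms by (intro ln_mono) auto
  thus ?thesis using assms by (simp add: ln_div ln_mult)
qed

text \<open>This is the auxiliary inequality of Hoeffding's lemma for a fair coin and step 2v with v
  \<ge> 0, since 1 + (exp(2v) - 1)/2 = exp v * cosh v. Evenness of cosh covers negative
  arguments.\<close>

lemma cosh_le_exp_half_square:
  fixes u :: real
  shows "cosh u \<le> exp (u\<^sup>2 / 2)"
proof -
  have *: "cosh v \<le> exp (v\<^sup>2 / 2)" if "v \<ge> 0" for v :: real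
  proof -
    have pos: "0 < 1 + (1/2) * (exp (2 * v) - 1)" by (simp add: field_simps add_pos_pos)
    have "ln (1 + (1/2) * (exp (2 * v) - 1)) \<le> v\<^sup>2 / 2 + v"
      using Hoeffdings_lemma_aux[of "2 * v" "1/2"] that by (simp add: power_mult_distrib)
    hence "1 + (1/2) * (exp (2 * v) - 1) \<le> exp (v\<^sup>2 / 2 + v)"
      using pos by (metis exp_le_cancel_iff exp_ln)
    moreover have "1 + (1/2) * (exp (2 * v) - 1) = exp v * cosh v"
      by (simp add: cosh_def field_simps flip: exp_add)
    ultimately have "exp v * cosh v \<le> exp v * exp (v\<^sup>2 / 2)" by (simp add: exp_add mult.commute)
    thus ?thesis by simp
  qed
  show ?thesis using *[of u] *[of "- u"] by (cases "u \<ge> 0") auto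
qed

section \<open>Gaussian integrals under an exponential tilt\<close>

text \<open>The term t^2/2 raises the inverse variance from (1 - b)/b to 1/b; completing the square
  then exhibits the density of N(bx, b).\<close>

lemma gaussian_tilt:
  fixes b x t :: real
  assumes "0 < b" "b < 1"
  shows "normal_density 0 (sqrt (b / (1 - b))) t * exp (x * t - t\<^sup>2 / 2) =
    sqrt (1 - b) * exp (b * x\<^sup>2 / 2) * normal_density (b * x) (sqrt b) t"
proof -
  have s: "(sqrt (b / (1 - b)))\<^sup>2 = b / (1 - b)" "(sqrt b)\<^sup>2 = b" using assms by simp_all
  have e: "- (t - 0)\<^sup>2 / (2 * (b / (1 - b))) + (x * t - t\<^sup>2 / 2) = b * x\<^sup>2 / 2 + - (t - b * x)\<^sup>2 / (2 * b)"
    using assms by (simp add: field_simps power2_eq_square)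
  have r: "1 / sqrt (2 * pi * (b / (1 - b))) = sqrt (1 - b) * (1 / sqrt (2 * pi * b))"
    using assms by (simp add: real_sqrt_divide real_sqrt_mult)
  show ?thesis
    unfolding normal_density_def s r using e by (simp add: mult.assoc flip: exp_add)
qed

lemma normal_second_moment:
  assumes "0 < \<sigma>"
  shows "has_bochner_integral lborel (\<lambda>t. normal_density \<mu> \<sigma> t * t\<^sup>2) (\<sigma>\<^sup>2 + \<mu>\<^sup>2)"
proof -
  have "has_bochner_integral lborel (\<lambda>t. normal_density \<mu> \<sigma> t * (t - \<mu>)\<^sup>2
      + (2 * \<mu>) * (normal_density \<mu> \<sigma> t * t) - \<mu>\<^sup>2 * normal_density \<mu> \<sigma> t) (\<sigma>\<^sup>2 + (2 * \<mu>) * \<mu> - \<mu>\<^sup>2 * 1)"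
    using normal_moment_even[OF assms, of \<mu> 1] normal_moment_nz_1[OF assms, of \<mu>]
      normal_moment_even[OF assms, of \<mu> 0] assms
    by (intro has_bochner_integral_diff has_bochner_integral_add has_bochner_integral_mult_right)
       (simp_all add: fact_numeral)
  thus ?thesis by (simp add: algebra_simps power2_eq_square)
qed

text \<open>Zeroth and second moments of the tilted density. The zeroth reproduces the Curie-Weiss
  weight, the second feeds the Chebyshev estimate of the truncation error.\<close>

lemma
  fixes b x :: real
  assumes "0 < b" "b < 1"
  shows normal_exp_moment: "has_bochner_integral lborel
      (\<lambda>t. normal_density 0 (sqrt (b / (1 - b))) t * exp (x * t - t\<^sup>2 / 2))
      (sqrt (1 - b) * exp (b * x\<^sup>2 / 2))"
    and normal_exp_second_moment: "has_bochner_integral lborel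
      (\<lambda>t. normal_density 0 (sqrt (b / (1 - b))) t * (exp (x * t - t\<^sup>2 / 2) * t\<^sup>2))
      (sqrt (1 - b) * exp (b * x\<^sup>2 / 2) * (b + b\<^sup>2 * x\<^sup>2))"
proof -
  show "has_bochner_integral lborel
      (\<lambda>t. normal_density 0 (sqrt (b / (1 - b))) t * exp (x * t - t\<^sup>2 / 2))
      (sqrt (1 - b) * exp (b * x\<^sup>2 / 2))"
    unfolding gaussian_tilt[OF assms]
    using has_bochner_integral_mult_right[OF normal_moment_even[of "sqrt b" "b * x" 0]] assms by simp
  show "has_bochner_integral lborel
      (\<lambda>t. normal_density 0 (sqrt (b / (1 - b))) t * (exp (x * t - t\<^sup>2 / 2) * t\<^sup>2))
      (sqrt (1 - b) * exp (b * x\<^sup>2 / 2) * (b + b\<^sup>2 * x\<^sup>2))"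
    unfolding mult.assoc[symmetric] gaussian_tilt[OF assms]
    using has_bochner_integral_mult_right[OF normal_second_moment[of "sqrt b" "b * x"],
      of "sqrt (1 - b) * exp (b * x\<^sup>2 / 2)"] assms
    by (simp add: power_mult_distrib mult.assoc)
qed

section \<open>Relative entropy on a finite set\<close>

text \<open>Strict positivity gives absolute continuity and finiteness of \<open>A\<close> gives
  integrability, so the infinite branch of the definition is never taken.\<close>

lemma relative_entropy_point_measure:
  fixes p q :: "'a \<Rightarrow> real"
  assumes A: "finite A" and p: "\<And>a. a \<in> A \<Longrightarrow> 0 < p a" and q: "\<And>a. a \<in> A \<Longrightarrow> 0 < q a"
  shows "relative_entropy (point_measure A p) (point_measure A q) = ereal (\<Sum>a\<in>A. p a * ln (p a / q a))"
proof -
  interpret sigma_finite_measure "count_space A"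
    using A by (rule sigma_finite_measure_count_space_finite)
  have "absolutely_continuous (point_measure A q) (point_measure A p)"
    using p q unfolding absolutely_continuous_def
    by (force simp: null_sets_point_measure_iff ennreal_eq_0_iff dest: less_imp_le)
  moreover have "integrable (point_measure A p) (entropy_density (exp 1) (point_measure A q) (point_measure A p))"
    by (rule integrable_point_measure_finite[OF A])
  moreover have "KL_divergence (exp 1) (point_measure A q) (point_measure A p) = (\<Sum>a\<in>A. p a * ln (p a / q a))"
    unfolding point_measure_def using A
    by (subst KL_density_density)
       (auto simp: AE_count_space less_imp_le p q lebesgue_integral_count_space_finite log_def dest: p q)
  ultimately show ?thesis by (simp add: relative_entropy_def)
qed

text \<open>Gibbs' inequality: ln u \<le> u - 1 at u = q/p bounds each summand below by p - q, and
  these differences sum to 0.\<close>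

lemma sum_mult_ln_ratio_nonneg:
  fixes p q :: "'a \<Rightarrow> real"
  assumes "finite A" and p: "\<And>a. a \<in> A \<Longrightarrow> 0 < p a" and q: "\<And>a. a \<in> A \<Longrightarrow> 0 < q a"
    and eq: "sum p A = sum q A"
  shows "0 \<le> (\<Sum>a\<in>A. p a * ln (p a / q a))"
proof -
  have "p a - q a \<le> p a * ln (p a / q a)" if "a \<in> A" for a
  proof -
    have "ln (q a / p a) \<le> q a / p a - 1" using p[OF that] q[OF that] by (intro ln_le_minus_one) simp
    hence "1 - q a / p a \<le> ln (p a / q a)" using p[OF that] q[OF that] by (simp add: ln_div)
    from mult_left_mono[OF this, of "p a"] show ?thesis using p[OF that] by (simp add: right_diff_distrib)
  qed
  hence "(\<Sum>a\<in>A. p a - q a) \<le> (\<Sum>a\<in>A. p a * ln (p a / q a))" by (rule sum_mono)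
  thus ?thesis using eq by (simp add: sum_subtractf)
qed

section \<open>Spin sums and the Curie-Weiss partition function\<close>

lemma finite_spin_configs [simp]: "finite (spin_configs N)"
  unfolding spin_configs_def by (intro finite_PiE) auto

lemma card_spin_configs: "card (spin_configs N) = 2 ^ N"
  by (simp add: spin_configs_def card_PiE numeral_2_eq_2)

lemma spin_configsD: "\<sigma> \<in> spin_configs N \<Longrightarrow> i \<in> {1..N} \<Longrightarrow> \<sigma> i = -1 \<or> \<sigma> i = 1"
  unfolding spin_configs_def by (auto simp: PiE_iff)

lemma sum_spin_configs_prod:
  fixes f :: "real \<Rightarrow> real"
  shows "(\<Sum>\<sigma>\<in>spin_configs N. \<Prod>i=1..N. f (\<sigma> i)) = (f (-1) + f 1) ^ N"
proof -
  have "(\<Sum>\<sigma>\<in>spin_configs N. \<Prod>i=1..N. f (\<sigma> i)) = (\<Prod>i=1..N. \<Sum>y\<in>{-1, 1}. f y)"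
    unfolding spin_configs_def by (subst prod_sum_PiE) auto
  thus ?thesis by simp
qed

text \<open>Central limit scaling; the Curie-Weiss weight depends on the configuration only through
  this number.\<close>

definition rescaled_magnetization :: "nat \<Rightarrow> (nat \<Rightarrow> real) \<Rightarrow> real" where
  "rescaled_magnetization N \<sigma> = (\<Sum>i=1..N. \<sigma> i) / sqrt (real N)"

lemma cw_weight_eq: "cw_weight \<beta> N \<sigma> = exp (\<beta> * (rescaled_magnetization N \<sigma>)\<^sup>2 / 2)"
proof -
  have "(\<Sum>i=1..N. \<Sum>j=1..N. \<sigma> i * \<sigma> j) = (\<Sum>i=1..N. \<sigma> i)\<^sup>2"
    by (simp add: power2_eq_square sum_product)
  thus ?thesis by (simp add: cw_weight_def rescaled_magnetization_def power_divide)
qed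

lemma cw_weight_ge_1: "0 \<le> \<beta> \<Longrightarrow> 1 \<le> cw_weight \<beta> N \<sigma>"
  by (simp add: cw_weight_eq)

lemma cw_partition_function_ge:
  assumes "0 \<le> \<beta>"
  shows "2 ^ N \<le> cw_partition_function \<beta> N"
proof -
  have "(\<Sum>\<sigma>\<in>spin_configs N. 1) \<le> cw_partition_function \<beta> N"
    unfolding cw_partition_function_def by (intro sum_mono cw_weight_ge_1 assms)
  thus ?thesis by (simp add: card_spin_configs)
qed

text \<open>The rescaled magnetization is sub-Gaussian with variance 1 under uniform spins: the sum
  factorizes into (2 cosh u)^N with u = t / sqrt N, and cosh u \<le> exp(u^2/2) turns this into 2^N
  exp(t^2/2).\<close>

lemma sum_exp_magnetization_le:
  assumes "0 < N"
  shows "(\<Sum>\<sigma>\<in>spin_configs N. exp (rescaled_magnetization N \<sigma> * t - t\<^sup>2 / 2)) \<le> 2 ^ N"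
proof -
  define u where "u = t / sqrt (real N)"
  have "exp (rescaled_magnetization N \<sigma> * t) = (\<Prod>i=1..N. exp (\<sigma> i * u))" for \<sigma>
    by (simp add: rescaled_magnetization_def u_def sum_distrib_right sum_divide_distrib flip: exp_sum)
  hence "(\<Sum>\<sigma>\<in>spin_configs N. exp (rescaled_magnetization N \<sigma> * t)) = (exp (- u) + exp u) ^ N"
    using sum_spin_configs_prod[where f = "\<lambda>y. exp (y * u)"] by simp
  also have "exp (- u) + exp u = 2 * cosh u" by (simp add: cosh_def)
  also have "(2 * cosh u) ^ N \<le> (2 * exp (u\<^sup>2 / 2)) ^ N"
    using cosh_le_exp_half_square[of u] by (intro power_mono) auto
  also have "\<dots> = 2 ^ N * exp (t\<^sup>2 / 2)"
    using assms by (simp add: power_mult_distrib u_def power_divide flip: exp_of_nat_mult)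
  finally show ?thesis
    by (simp add: exp_diff pos_divide_le_eq flip: sum_divide_distrib)
qed

text \<open>Sums over \<open>\<sigma>\<close> the Gaussian linearization of \<open>exp (\<beta> x\<^sup>2 / 2)\<close> (Hubbard--Stratonovich).\<close>
lemma cw_partition_function_le:
  assumes "0 < \<beta>" "\<beta> < 1" "0 < N"
  shows "sqrt (1 - \<beta>) * cw_partition_function \<beta> N \<le> 2 ^ N"
proof -
  define \<phi> where "\<phi> = normal_density 0 (sqrt (\<beta> / (1 - \<beta>)))"
  have s: "0 < sqrt (\<beta> / (1 - \<beta>))" using assms by simp
  have "has_bochner_integral lborel
      (\<lambda>t. \<Sum>\<sigma>\<in>spin_configs N. \<phi> t * exp (rescaled_magnetization N \<sigma> * t - t\<^sup>2 / 2))
      (\<Sum>\<sigma>\<in>spin_configs N. sqrt (1 - \<beta>) * exp (\<beta> * (rescaled_magnetization N \<sigma>)\<^sup>2 / 2))"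
    unfolding \<phi>_def by (intro has_bochner_integral_sum normal_exp_moment assms)
  moreover have "(\<Sum>\<sigma>\<in>spin_configs N. \<phi> t * exp (rescaled_magnetization N \<sigma> * t - t\<^sup>2 / 2)) \<le> 2 ^ N * \<phi> t" for t
    using mult_left_mono[OF sum_exp_magnetization_le[OF assms(3), of t], of "\<phi> t"]
    by (simp add: \<phi>_def sum_distrib_left mult.commute)
  moreover have "has_bochner_integral lborel (\<lambda>t. 2 ^ N * \<phi> t) (2 ^ N * 1)"
    using s by (intro has_bochner_integral_mult_right) (simp add: \<phi>_def has_bochner_integral_iff)
  ultimately have "(\<Sum>\<sigma>\<in>spin_configs N. sqrt (1 - \<beta>) * exp (\<beta> * (rescaled_magnetization N \<sigma>)\<^sup>2 / 2)) \<le> 2 ^ N * 1"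
    by (metis (no_types, lifting) has_bochner_integral_iff integral_mono)
  thus ?thesis by (simp add: cw_partition_function_def cw_weight_eq sum_distrib_left)
qed

text \<open>Expand the logarithm of each factor. Because every squared spin is 1, the quadratic
  terms add up to t^2/2, and the N cubic errors add up to |t|^3 / sqrt N. The bound on
  \<open>m\<close> keeps |u| \<le> 1/2, the range of the logarithm estimate.\<close>

lemma prod_spin_tilt_bounds:
  fixes t m :: real
  assumes N: "0 < N" and \<sigma>: "\<sigma> \<in> spin_configs N" and t: "\<bar>t\<bar> \<le> m" and m: "m \<le> sqrt (real N) / 2"
  defines "P \<equiv> \<Prod>i=1..N. 1 + \<sigma> i * (t / sqrt (real N))"
    and "q \<equiv> exp (rescaled_magnetization N \<sigma> * t - t\<^sup>2 / 2)" and "\<epsilon> \<equiv> m ^ 3 / sqrt (real N)"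
  shows "exp (- \<epsilon>) * q \<le> P" "P \<le> exp \<epsilon> * q"
proof -
  define u where "u = t / sqrt (real N)"
  have N0: "0 < sqrt (real N)" using N by simp
  have u: "\<bar>u\<bar> \<le> 1 / 2" using t m N0 by (simp add: u_def field_simps)
  have abs_\<sigma>: "\<bar>\<sigma> i * u\<bar> = \<bar>u\<bar>" "(\<sigma> i * u)\<^sup>2 = u\<^sup>2" "0 < 1 + \<sigma> i * u" if "i \<in> {1..N}" for i
    using spin_configsD[OF \<sigma> that] u by auto
  have "P = exp (\<Sum>i=1..N. ln (1 + \<sigma> i * u))"
    unfolding P_def u_def[symmetric] using abs_\<sigma>(3) by (simp add: exp_sum)
  moreover have "rescaled_magnetization N \<sigma> * t - t\<^sup>2 / 2 = (\<Sum>i=1..N. \<sigma> i * u - u\<^sup>2 / 2)"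
    using N by (simp add: rescaled_magnetization_def u_def sum_subtractf sum_distrib_right
        sum_divide_distrib power_divide)
  moreover have "\<bar>(\<Sum>i=1..N. ln (1 + \<sigma> i * u)) - (\<Sum>i=1..N. \<sigma> i * u - u\<^sup>2 / 2)\<bar> \<le> \<epsilon>"
  proof -
    have "\<bar>ln (1 + \<sigma> i * u) - (\<sigma> i * u - u\<^sup>2 / 2)\<bar> \<le> \<bar>u\<bar> ^ 3" if "i \<in> {1..N}" for i
      using abs_ln_one_plus_minus_quadratic_le[of "\<sigma> i * u"] abs_\<sigma>[OF that] u by simp
    hence "\<bar>\<Sum>i=1..N. ln (1 + \<sigma> i * u) - (\<sigma> i * u - u\<^sup>2 / 2)\<bar> \<le> (\<Sum>i=1..N. \<bar>u\<bar> ^ 3)"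
      by (intro order_trans[OF sum_abs] sum_mono)
    also have "\<dots> = \<bar>t\<bar> ^ 3 / sqrt (real N)"
      using N by (simp add: u_def power_divide power3_eq_cube)
    also have "\<dots> \<le> \<epsilon>" unfolding \<epsilon>_def using t by (intro divide_right_mono power_mono) auto
    finally show ?thesis by (simp add: sum_subtractf)
  qed
  ultimately show "exp (- \<epsilon>) * q \<le> P" "P \<le> exp \<epsilon> * q"
    by (simp_all add: q_def abs_le_iff flip: exp_add)
qed

section \<open>The truncated Gaussian variable and its tilts\<close>

locale gaussian_mixture = prob_space M for M :: "'w measure" +
  fixes X :: "'w \<Rightarrow> real" and \<beta> \<delta> :: real
  assumes beta_pos: "0 < \<beta>" and beta_less_1: "\<beta> < 1"
    and X_dist: "distributed M lborel X (normal_density 0 (sqrt (\<beta> / (1 - \<beta>))))"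
begin

text \<open>Density of the mixture with respect to the uniform law, hence without the factor
  \<open>1 / 2 ^ N\<close>.\<close>

definition mixture_mass :: "nat \<Rightarrow> (nat \<Rightarrow> real) \<Rightarrow> real" where
  "mixture_mass N \<sigma> = (\<integral>\<omega>. (\<Prod>i=1..N. 1 + \<sigma> i * (truncated_rv X \<delta> N \<omega> / sqrt (real N))) \<partial>M)"

lemma X_measurable [measurable]: "X \<in> borel_measurable M"
  using distributed_measurable[OF X_dist] by simp

lemma has_bochner_integral_X:
  assumes "has_bochner_integral lborel (\<lambda>t. normal_density 0 (sqrt (\<beta> / (1 - \<beta>))) t * g t) (v :: real)"
    and [measurable]: "g \<in> borel_measurable borel"
  shows "has_bochner_integral M (\<lambda>\<omega>. g (X \<omega>)) v"
  using assms distributed_integrable[OF X_dist, of g] distributed_integral[OF X_dist, of g]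
  by (simp add: has_bochner_integral_iff)

lemma exp_moment:
  "has_bochner_integral M (\<lambda>\<omega>. exp (x * X \<omega> - (X \<omega>)\<^sup>2 / 2)) (sqrt (1 - \<beta>) * exp (\<beta> * x\<^sup>2 / 2))"
  by (rule has_bochner_integral_X[OF normal_exp_moment]) (use beta_pos beta_less_1 in auto)

lemma exp_second_moment:
  "has_bochner_integral M (\<lambda>\<omega>. exp (x * X \<omega> - (X \<omega>)\<^sup>2 / 2) * (X \<omega>)\<^sup>2)
     (sqrt (1 - \<beta>) * exp (\<beta> * x\<^sup>2 / 2) * (\<beta> + \<beta>\<^sup>2 * x\<^sup>2))"
  by (rule has_bochner_integral_X[OF normal_exp_second_moment]) (use beta_pos beta_less_1 in auto)

lemma second_moment: "has_bochner_integral M (\<lambda>\<omega>. (X \<omega>)\<^sup>2) (\<beta> / (1 - \<beta>))"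
proof (rule has_bochner_integral_X)
  have "0 < sqrt (\<beta> / (1 - \<beta>))" using beta_pos beta_less_1 by simp
  from normal_second_moment[OF this, of 0] beta_pos beta_less_1
  show "has_bochner_integral lborel (\<lambda>t. normal_density 0 (sqrt (\<beta> / (1 - \<beta>))) t * t\<^sup>2) (\<beta> / (1 - \<beta>))"
    by simp
qed auto

lemma truncated_measurable [measurable]: "truncated_rv X \<delta> N \<in> borel_measurable M"
  unfolding truncated_rv_def by measurable

lemma truncated_cases:
  "truncated_rv X \<delta> N \<omega> = (if \<bar>X \<omega>\<bar> \<le> real N powr \<delta> then X \<omega> else 0)"
  by (simp add: truncated_rv_def indicator_def)

lemma abs_truncated_le: "\<bar>truncated_rv X \<delta> N \<omega>\<bar> \<le> real N powr \<delta>"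
  by (simp add: truncated_cases)

text \<open>Beyond the cutoff the truncated variable is 0 and its tilt is 1, which the Chebyshev
  quotient dominates. The right-hand side has an explicit expectation.\<close>

lemma tilt_truncated_le:
  assumes "0 < N"
  shows "exp (x * truncated_rv X \<delta> N \<omega> - (truncated_rv X \<delta> N \<omega>)\<^sup>2 / 2)
    \<le> exp (x * X \<omega> - (X \<omega>)\<^sup>2 / 2) + (X \<omega>)\<^sup>2 / (real N powr \<delta>)\<^sup>2"
proof (cases "\<bar>X \<omega>\<bar> \<le> real N powr \<delta>")
  case False
  hence "(real N powr \<delta>)\<^sup>2 \<le> (X \<omega>)\<^sup>2" by (simp add: flip: abs_le_square_iff)
  hence "1 \<le> (X \<omega>)\<^sup>2 / (real N powr \<delta>)\<^sup>2" using assms by simp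
  with False show ?thesis by (simp add: truncated_cases add_increasing)
qed (simp add: truncated_cases)

text \<open>The added factor is at most 1 within the cutoff and nonpositive beyond it, so it
  replaces the indicator of the cutoff by something with an explicit expectation.\<close>

lemma tilt_truncated_ge:
  assumes "0 < N"
  shows "exp (x * X \<omega> - (X \<omega>)\<^sup>2 / 2) * (1 - (X \<omega>)\<^sup>2 / (real N powr \<delta>)\<^sup>2)
    \<le> exp (x * truncated_rv X \<delta> N \<omega> - (truncated_rv X \<delta> N \<omega>)\<^sup>2 / 2)"
proof (cases "\<bar>X \<omega>\<bar> \<le> real N powr \<delta>")
  case False
  hence "(real N powr \<delta>)\<^sup>2 \<le> (X \<omega>)\<^sup>2" by (simp add: flip: abs_le_square_iff)
  hence "1 - (X \<omega>)\<^sup>2 / (real N powr \<delta>)\<^sup>2 \<le> 0" using assms by simp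
  hence "exp (x * X \<omega> - (X \<omega>)\<^sup>2 / 2) * (1 - (X \<omega>)\<^sup>2 / (real N powr \<delta>)\<^sup>2) \<le> 0"
    by (simp add: mult_nonneg_nonpos)
  with False show ?thesis by (simp add: truncated_cases)
qed (simp add: truncated_cases mult_left_le)

text \<open>The coefficients come from \<open>(exp (- X\<^sup>2 / 2) - sqrt (1 - \<beta>))\<^sup>2 \<ge> 0\<close>, whose mixed term has
  a known expectation.\<close>
lemma tilt_truncated_crude:
  "exp (- x\<^sup>2 / 2) * (2 * sqrt (1 - \<beta>) * exp (0 * X \<omega> - (X \<omega>)\<^sup>2 / 2) - (1 - \<beta>))
    \<le> exp (x * truncated_rv X \<delta> N \<omega> - (truncated_rv X \<delta> N \<omega>)\<^sup>2 / 2)"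
proof -
  define y where "y = truncated_rv X \<delta> N \<omega>"
  have "0 \<le> (exp (- (X \<omega>)\<^sup>2 / 2) - sqrt (1 - \<beta>))\<^sup>2" by simp
  also have "\<dots> = exp (- (X \<omega>)\<^sup>2) - (2 * sqrt (1 - \<beta>) * exp (- (X \<omega>)\<^sup>2 / 2) - (1 - \<beta>))"
    using beta_less_1 by (simp add: power2_diff mult_ac flip: exp_double)
  finally have 1: "2 * sqrt (1 - \<beta>) * exp (0 * X \<omega> - (X \<omega>)\<^sup>2 / 2) - (1 - \<beta>) \<le> exp (- (X \<omega>)\<^sup>2)"
    by simp
  have "y\<^sup>2 \<le> (X \<omega>)\<^sup>2" by (simp add: y_def truncated_cases)
  moreover have "0 \<le> (x + y)\<^sup>2" by simp
  ultimately have "- x\<^sup>2 / 2 + - (X \<omega>)\<^sup>2 \<le> x * y - y\<^sup>2 / 2" by (simp add: power2_sum)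
  hence "exp (- x\<^sup>2 / 2) * exp (- (X \<omega>)\<^sup>2) \<le> exp (x * y - y\<^sup>2 / 2)" by (simp flip: exp_add)
  with mult_left_mono[OF 1, of "exp (- x\<^sup>2 / 2)"] show ?thesis
    unfolding y_def[symmetric] by (meson exp_ge_zero order_trans)
qed

lemma integrable_tilt_truncated:
  "integrable M (\<lambda>\<omega>. exp (x * truncated_rv X \<delta> N \<omega> - (truncated_rv X \<delta> N \<omega>)\<^sup>2 / 2))"
proof (rule integrable_const_bound)
  show "AE \<omega> in M. norm (exp (x * truncated_rv X \<delta> N \<omega> - (truncated_rv X \<delta> N \<omega>)\<^sup>2 / 2)) \<le> exp (\<bar>x\<bar> * real N powr \<delta>)"
  proof (intro AE_I2)
    fix \<omega>
    have "x * truncated_rv X \<delta> N \<omega> \<le> \<bar>x\<bar> * \<bar>truncated_rv X \<delta> N \<omega>\<bar>"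
      by (metis abs_ge_self abs_mult)
    also have "\<dots> \<le> \<bar>x\<bar> * real N powr \<delta>" by (intro mult_left_mono abs_truncated_le) simp
    finally have "x * truncated_rv X \<delta> N \<omega> - (truncated_rv X \<delta> N \<omega>)\<^sup>2 / 2 \<le> \<bar>x\<bar> * real N powr \<delta>"
      using zero_le_power2[of "truncated_rv X \<delta> N \<omega>"] by linarith
    thus "norm (exp (x * truncated_rv X \<delta> N \<omega> - (truncated_rv X \<delta> N \<omega>)\<^sup>2 / 2)) \<le> exp (\<bar>x\<bar> * real N powr \<delta>)"
      by simp
  qed
qed measurable

section \<open>Bounds on the mixture mass at a fixed N\<close>

context
  fixes N :: nat
  assumes N_pos: "0 < N" and m_le: "real N powr \<delta> \<le> sqrt (real N) / 2"
begin

private abbreviation "m \<equiv> real N powr \<delta>"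
private abbreviation "\<epsilon> \<equiv> m ^ 3 / sqrt (real N)"
private abbreviation "tilt \<sigma> \<omega> \<equiv>
  exp (rescaled_magnetization N \<sigma> * truncated_rv X \<delta> N \<omega> - (truncated_rv X \<delta> N \<omega>)\<^sup>2 / 2)"

lemmas prod_bounds = prod_spin_tilt_bounds[OF N_pos _ abs_truncated_le m_le]

lemma integrable_spin_prod:
  assumes "\<sigma> \<in> spin_configs N"
  shows "integrable M (\<lambda>\<omega>. \<Prod>i=1..N. 1 + \<sigma> i * (truncated_rv X \<delta> N \<omega> / sqrt (real N)))"
proof (rule Bochner_Integration.integrable_bound)
  show "integrable M (\<lambda>\<omega>. exp \<epsilon> * tilt \<sigma> \<omega>)"
    by (intro integrable_mult_right integrable_tilt_truncated)
  show "AE \<omega> in M. norm (\<Prod>i=1..N. 1 + \<sigma> i * (truncated_rv X \<delta> N \<omega> / sqrt (real N)))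
      \<le> norm (exp \<epsilon> * tilt \<sigma> \<omega>)"
  proof (intro AE_I2)
    fix \<omega>
    have "0 \<le> exp (- \<epsilon>) * tilt \<sigma> \<omega>" by simp
    also note prod_bounds(1)[OF assms]
    finally show "norm (\<Prod>i=1..N. 1 + \<sigma> i * (truncated_rv X \<delta> N \<omega> / sqrt (real N)))
      \<le> norm (exp \<epsilon> * tilt \<sigma> \<omega>)"
      using prod_bounds(2)[OF assms, of \<omega>] by (simp add: abs_mult)
  qed
qed measurable

lemma mixture_mass_bounds_tilt:
  assumes "\<sigma> \<in> spin_configs N"
  shows "exp (- \<epsilon>) * (\<integral>\<omega>. tilt \<sigma> \<omega> \<partial>M) \<le> mixture_mass N \<sigma>"
    and "mixture_mass N \<sigma> \<le> exp \<epsilon> * (\<integral>\<omega>. tilt \<sigma> \<omega> \<partial>M)"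
  unfolding mixture_mass_def integral_mult_right_zero[symmetric]
  by (intro integral_mono integrable_mult_right integrable_tilt_truncated
      integrable_spin_prod prod_bounds assms)+

text \<open>Takes expectations in \<open>tilt_truncated_le\<close>; \<beta>/(1 - \<beta>) is the
  second moment of \<open>X\<close>.\<close>

lemma mixture_mass_le:
  assumes "\<sigma> \<in> spin_configs N"
  shows "mixture_mass N \<sigma> \<le> exp \<epsilon> * (sqrt (1 - \<beta>) * cw_weight \<beta> N \<sigma> + \<beta> / (1 - \<beta>) / m\<^sup>2)"
proof -
  define x where "x = rescaled_magnetization N \<sigma>"
  have *: "has_bochner_integral M (\<lambda>\<omega>. exp (x * X \<omega> - (X \<omega>)\<^sup>2 / 2) + (X \<omega>)\<^sup>2 / m\<^sup>2)
      (sqrt (1 - \<beta>) * exp (\<beta> * x\<^sup>2 / 2) + \<beta> / (1 - \<beta>) / m\<^sup>2)"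
    by (intro has_bochner_integral_add exp_moment has_bochner_integral_divide second_moment)
  have "(\<integral>\<omega>. tilt \<sigma> \<omega> \<partial>M) \<le> (\<integral>\<omega>. exp (x * X \<omega> - (X \<omega>)\<^sup>2 / 2) + (X \<omega>)\<^sup>2 / m\<^sup>2 \<partial>M)"
    unfolding x_def[symmetric]
    by (intro integral_mono integrable_tilt_truncated tilt_truncated_le N_pos integrable.intros[OF *])
  thus ?thesis
    using mixture_mass_bounds_tilt(2)[OF assms] *
    by (auto simp: has_bochner_integral_iff cw_weight_eq x_def intro: order_trans mult_left_mono)
qed

text \<open>Takes expectations in \<open>tilt_truncated_ge\<close>;
  \<open>\<beta> + \<beta>\<^sup>2 * x\<^sup>2\<close> is the second moment of the tilted law
  N(\<beta>x, \<beta>).\<close>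

lemma mixture_mass_ge:
  assumes "\<sigma> \<in> spin_configs N"
  shows "exp (- \<epsilon>) * (sqrt (1 - \<beta>) * cw_weight \<beta> N \<sigma> *
    (1 - (\<beta> + \<beta>\<^sup>2 * (rescaled_magnetization N \<sigma>)\<^sup>2) / m\<^sup>2)) \<le> mixture_mass N \<sigma>"
proof -
  define x where "x = rescaled_magnetization N \<sigma>"
  define c where "c = sqrt (1 - \<beta>) * exp (\<beta> * x\<^sup>2 / 2)"
  have "has_bochner_integral M (\<lambda>\<omega>. exp (x * X \<omega> - (X \<omega>)\<^sup>2 / 2) - exp (x * X \<omega> - (X \<omega>)\<^sup>2 / 2) * (X \<omega>)\<^sup>2 / m\<^sup>2)
      (c - c * (\<beta> + \<beta>\<^sup>2 * x\<^sup>2) / m\<^sup>2)"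
    unfolding c_def
    by (intro has_bochner_integral_diff exp_moment has_bochner_integral_divide exp_second_moment)
  hence *: "has_bochner_integral M (\<lambda>\<omega>. exp (x * X \<omega> - (X \<omega>)\<^sup>2 / 2) * (1 - (X \<omega>)\<^sup>2 / m\<^sup>2))
      (c * (1 - (\<beta> + \<beta>\<^sup>2 * x\<^sup>2) / m\<^sup>2))"
    by (simp add: right_diff_distrib)
  have "(\<integral>\<omega>. exp (x * X \<omega> - (X \<omega>)\<^sup>2 / 2) * (1 - (X \<omega>)\<^sup>2 / m\<^sup>2) \<partial>M) \<le> (\<integral>\<omega>. tilt \<sigma> \<omega> \<partial>M)"
    unfolding x_def[symmetric]
    by (intro integral_mono integrable_tilt_truncated tilt_truncated_ge N_pos integrable.intros[OF *])
  thus ?thesis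
    using mixture_mass_bounds_tilt(1)[OF assms] *
    by (auto simp: has_bochner_integral_iff cw_weight_eq x_def c_def intro: order_trans[rotated] mult_left_mono)
qed

text \<open>Serves configurations of large magnetization, where the bound in
  \<open>mixture_mass_ge\<close> can be negative. Losing a factor exponential in x^2 is affordable
  because it enters the entropy only through its logarithm.\<close>

lemma mixture_mass_ge_crude:
  assumes "\<sigma> \<in> spin_configs N"
  shows "exp (- \<epsilon>) * (exp (- (rescaled_magnetization N \<sigma>)\<^sup>2 / 2) * (1 - \<beta>)) \<le> mixture_mass N \<sigma>"
proof -
  define x where "x = rescaled_magnetization N \<sigma>"
  have const: "has_bochner_integral M (\<lambda>_. 1 - \<beta>) (1 - \<beta>)"
    unfolding has_bochner_integral_iff by (simp add: prob_space del: Bochner_Integration.integral_diff)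
  have "has_bochner_integral M (\<lambda>\<omega>. exp (- x\<^sup>2 / 2) * (2 * sqrt (1 - \<beta>) * exp (0 * X \<omega> - (X \<omega>)\<^sup>2 / 2) - (1 - \<beta>)))
      (exp (- x\<^sup>2 / 2) * (2 * sqrt (1 - \<beta>) * (sqrt (1 - \<beta>) * exp (\<beta> * 0\<^sup>2 / 2)) - (1 - \<beta>)))"
    by (intro has_bochner_integral_mult_right has_bochner_integral_diff[OF _ const] exp_moment)
  hence *: "has_bochner_integral M (\<lambda>\<omega>. exp (- x\<^sup>2 / 2) * (2 * sqrt (1 - \<beta>) * exp (0 * X \<omega> - (X \<omega>)\<^sup>2 / 2) - (1 - \<beta>)))
      (exp (- x\<^sup>2 / 2) * (1 - \<beta>))"
    using beta_less_1 by (simp add: mult.assoc)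
  have "(\<integral>\<omega>. exp (- x\<^sup>2 / 2) * (2 * sqrt (1 - \<beta>) * exp (0 * X \<omega> - (X \<omega>)\<^sup>2 / 2) - (1 - \<beta>)) \<partial>M)
      \<le> (\<integral>\<omega>. tilt \<sigma> \<omega> \<partial>M)"
    unfolding x_def[symmetric]
    by (intro integral_mono integrable_tilt_truncated tilt_truncated_crude integrable.intros[OF *])
  thus ?thesis
    using mixture_mass_bounds_tilt(1)[OF assms] *
    by (auto simp: has_bochner_integral_iff x_def intro: order_trans[rotated] mult_left_mono)
qed

lemma mixture_mass_pos:
  assumes "\<sigma> \<in> spin_configs N"
  shows "0 < mixture_mass N \<sigma>"
  by (rule less_le_trans[OF _ mixture_mass_ge_crude[OF assms]]) (use beta_less_1 in simp)

text \<open>At each site the factors 1 - u and 1 + u add up to 2, whatever the value of the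
  truncated variable.\<close>

lemma sum_mixture_mass: "(\<Sum>\<sigma>\<in>spin_configs N. mixture_mass N \<sigma>) = 2 ^ N"
proof -
  have "(\<Sum>\<sigma>\<in>spin_configs N. mixture_mass N \<sigma>)
      = (\<integral>\<omega>. (\<Sum>\<sigma>\<in>spin_configs N. \<Prod>i=1..N. 1 + \<sigma> i * (truncated_rv X \<delta> N \<omega> / sqrt (real N))) \<partial>M)"
    unfolding mixture_mass_def by (rule Bochner_Integration.integral_sum[symmetric]) (rule integrable_spin_prod)
  also have "\<dots> = (\<integral>\<omega>. 2 ^ N \<partial>M)"
    by (subst sum_spin_configs_prod) simp
  finally show ?thesis by (simp add: prob_space)
qed


section \<open>Pointwise comparison of the two normalized mass functions\<close>

private abbreviation "Z \<equiv> cw_partition_function \<beta> N"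
private abbreviation "p \<sigma> \<equiv> cw_weight \<beta> N \<sigma> / Z"
private abbreviation "q \<sigma> \<equiv> 1 / 2 ^ N * mixture_mass N \<sigma>"
text \<open>Ratio of the Gaussian prefactor times \<open>Z\<close> to its limiting value; it is
  squeezed between \<open>exp (- (\<epsilon> + a))\<close> and 1 below.\<close>

private abbreviation "\<kappa> \<equiv> sqrt (1 - \<beta>) * Z / 2 ^ N"
text \<open>Truncation error relative to \<open>sqrt (1 - \<beta>)\<close>, a lower bound of the
  main term in \<open>mixture_mass_le\<close>.\<close>

private abbreviation "a \<equiv> \<beta> / (1 - \<beta>) / (sqrt (1 - \<beta>) * m\<^sup>2)"

lemma Z_pos: "0 < Z"
  using cw_partition_function_ge[of \<beta> N] beta_pos by (simp add: less_le_trans[of 0 "2 ^ N"])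

lemma p_pos: "0 < p \<sigma>"
  using Z_pos by (simp add: cw_weight_eq)

lemma q_pos: "\<sigma> \<in> spin_configs N \<Longrightarrow> 0 < q \<sigma>"
  using mixture_mass_pos by simp

lemma sum_p: "sum p (spin_configs N) = 1"
  using Z_pos by (simp add: cw_partition_function_def flip: sum_divide_distrib)

lemma sum_q: "(\<Sum>\<sigma>\<in>spin_configs N. q \<sigma>) = 1"
  using sum_mixture_mass by (simp flip: sum_divide_distrib)

lemma eps_nonneg: "0 \<le> \<epsilon>"
  by simp

text \<open>Since the Curie-Weiss weight is at least 1, the additive truncation error in
  \<open>mixture_mass_le\<close> is absorbed into a factor 1 + a \<le> exp a.\<close>

lemma mixture_le_curie_weiss:
  assumes "\<sigma> \<in> spin_configs N"
  shows "q \<sigma> \<le> p \<sigma> * (\<kappa> * exp (\<epsilon> + a))"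
proof -
  define c where "c = sqrt (1 - \<beta>)"
  define w where "w = cw_weight \<beta> N \<sigma>"
  have c: "0 < c" using beta_less_1 by (simp add: c_def)
  have w: "1 \<le> w" using cw_weight_ge_1 beta_pos by (simp add: w_def)
  have a0: "0 \<le> a" using beta_pos beta_less_1 by simp
  have "\<beta> / (1 - \<beta>) / m\<^sup>2 = c * 1 * a" using c by (simp add: c_def)
  also have "\<dots> \<le> c * w * a" using c w a0 by (intro mult_right_mono mult_left_mono) auto
  finally have "c * w + \<beta> / (1 - \<beta>) / m\<^sup>2 \<le> c * w * (1 + a)" by (simp only: ring_distribs mult_1_right)
  also have "\<dots> \<le> c * w * exp a" using c w by (intro mult_left_mono exp_ge_add_one_self) auto
  finally have "mixture_mass N \<sigma> \<le> exp \<epsilon> * (c * w * exp a)"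
    using mixture_mass_le[OF assms] unfolding c_def w_def
    by (meson exp_ge_zero mult_left_mono order_trans)
  hence "q \<sigma> \<le> 1 / 2 ^ N * (exp \<epsilon> * (c * w * exp a))" by (intro mult_left_mono) auto
  also have "\<dots> = p \<sigma> * (\<kappa> * exp (\<epsilon> + a))"
    using Z_pos by (simp add: exp_add c_def w_def)
  finally show ?thesis .
qed

lemma normalization_le: "\<kappa> \<le> 1"
  using cw_partition_function_le[OF beta_pos beta_less_1 N_pos] by simp

text \<open>Both mass functions sum to 1, so summing \<open>mixture_le_curie_weiss\<close> already
  bounds the partition function from below.\<close>

lemma normalization_ge: "1 \<le> \<kappa> * exp (\<epsilon> + a)"
proof -
  have "(\<Sum>\<sigma>\<in>spin_configs N. q \<sigma>) \<le> (\<Sum>\<sigma>\<in>spin_configs N. p \<sigma> * (\<kappa> * exp (\<epsilon> + a)))"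
    by (intro sum_mono mixture_le_curie_weiss)
  also have "\<dots> = sum p (spin_configs N) * (\<kappa> * exp (\<epsilon> + a))" by (rule sum_distrib_right[symmetric])
  finally show ?thesis using sum_p sum_q by simp
qed

lemma ln_mixture_ratio_le:
  assumes "\<sigma> \<in> spin_configs N"
  shows "ln (q \<sigma> / p \<sigma>) \<le> \<epsilon> + a"
proof -
  have "p \<sigma> * (\<kappa> * exp (\<epsilon> + a)) \<le> p \<sigma> * (1 * exp (\<epsilon> + a))"
    by (intro mult_left_mono mult_right_mono normalization_le less_imp_le[OF p_pos] exp_ge_zero)
  with mixture_le_curie_weiss[OF assms] have "q \<sigma> \<le> exp (\<epsilon> + a) * p \<sigma>" by (simp add: mult.commute)
  thus ?thesis by (rule ln_divide_le_of_le_exp[OF q_pos[OF assms] p_pos])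
qed

text \<open>One \<epsilon> and the \<open>a\<close> come from \<open>normalization_ge\<close>, the
  second \<epsilon> from \<open>mixture_mass_ge\<close>, and 4/m from its Chebyshev factor, which is
  at least 1 - 2/m here.\<close>

lemma curie_weiss_le_mixture_typical:
  assumes \<sigma>: "\<sigma> \<in> spin_configs N" and m4: "4 \<le> m" and x: "(rescaled_magnetization N \<sigma>)\<^sup>2 \<le> m"
  shows "p \<sigma> \<le> exp (2 * \<epsilon> + a + 4 / m) * q \<sigma>"
proof -
  define x where "x = rescaled_magnetization N \<sigma>"
  have "\<beta>\<^sup>2 * x\<^sup>2 \<le> 1 * m"
    using x beta_pos beta_less_1 by (intro mult_mono) (auto simp: x_def power_le_one)
  hence "(\<beta> + \<beta>\<^sup>2 * x\<^sup>2) / m\<^sup>2 \<le> (2 * m) / m\<^sup>2"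
    using m4 beta_less_1 by (intro divide_right_mono) auto
  also have "\<dots> = 2 / m" using m4 by (simp add: power2_eq_square)
  finally have 1: "1 - 2 / m \<le> 1 - (\<beta> + \<beta>\<^sup>2 * x\<^sup>2) / m\<^sup>2" by simp
  define y where "y = 2 / m"
  have y: "0 \<le> y" "y \<le> 1 / 2" using m4 by (auto simp: y_def divide_le_eq)
  \<comment> \<open>From y \<le> 1/2, that is 4 \<le> m, the quadratic loss 2y^2 in the lower bound
    for ln(1 - y) is at most y, for a total of 2y = 4/m.\<close>
  have "y * y \<le> y * (1 / 2)" using y by (intro mult_left_mono)
  hence "- (4 / m) \<le> - y - 2 * y\<^sup>2" by (simp add: y_def power2_eq_square)
  also have "\<dots> \<le> ln (1 - y)" using y by (intro ln_one_minus_pos_lower_bound)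
  finally have "exp (- (4 / m)) \<le> 1 - 2 / m" using y by (simp add: y_def[symmetric] ln_ge_iff)
  with 1 have 2: "exp (- (4 / m)) \<le> 1 - (\<beta> + \<beta>\<^sup>2 * x\<^sup>2) / m\<^sup>2" by simp
  have "p \<sigma> * 1 \<le> p \<sigma> * (\<kappa> * exp (\<epsilon> + a))"
    by (intro mult_left_mono normalization_ge less_imp_le[OF p_pos])
  also have "\<dots> = exp (2 * \<epsilon> + a + 4 / m) * (1 / 2 ^ N * (exp (- \<epsilon>) * (sqrt (1 - \<beta>) * cw_weight \<beta> N \<sigma> * exp (- (4 / m)))))"
  proof -
    have "exp (\<epsilon> + a) = exp (2 * \<epsilon> + a + 4 / m) * (exp (- \<epsilon>) * exp (- (4 / m)))"
      by (simp flip: exp_add)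
    thus ?thesis using Z_pos by (simp only:) simp
  qed
  also have "\<dots> \<le> exp (2 * \<epsilon> + a + 4 / m) * (1 / 2 ^ N * (exp (- \<epsilon>) * (sqrt (1 - \<beta>) * cw_weight \<beta> N \<sigma> * (1 - (\<beta> + \<beta>\<^sup>2 * x\<^sup>2) / m\<^sup>2))))"
    using beta_less_1 by (intro mult_left_mono 2) (auto simp: cw_weight_eq)
  also have "\<dots> \<le> exp (2 * \<epsilon> + a + 4 / m) * q \<sigma>"
    unfolding x_def by (intro mult_left_mono mixture_mass_ge \<sigma>) auto
  finally show ?thesis by simp
qed

text \<open>The weight and the bound of \<open>mixture_mass_ge_crude\<close> each cost at most x^2/2
  in the exponent, the factor 1 - \<beta> costs its logarithm, and \<open>Z\<close> is at least
  2^N.\<close>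

lemma curie_weiss_le_mixture_crude:
  assumes \<sigma>: "\<sigma> \<in> spin_configs N"
  shows "p \<sigma> \<le> exp (\<epsilon> - ln (1 - \<beta>) + (rescaled_magnetization N \<sigma>)\<^sup>2) * q \<sigma>"
proof -
  define x where "x = rescaled_magnetization N \<sigma>"
  have "\<beta> * x\<^sup>2 \<le> 1 * x\<^sup>2" using beta_less_1 by (intro mult_right_mono) auto
  hence "cw_weight \<beta> N \<sigma> \<le> exp (x\<^sup>2 - x\<^sup>2 / 2)" by (simp add: cw_weight_eq x_def)
  hence "p \<sigma> \<le> exp (x\<^sup>2 - x\<^sup>2 / 2) / 2 ^ N"
    using cw_partition_function_ge[of \<beta> N] beta_pos by (intro frac_le) auto
  also have "exp (x\<^sup>2 - x\<^sup>2 / 2) = exp (\<epsilon> - ln (1 - \<beta>) + x\<^sup>2) * (exp (- \<epsilon>) * (exp (- x\<^sup>2 / 2) * exp (ln (1 - \<beta>))))"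
    by (simp flip: exp_add)
  also have "\<dots> / 2 ^ N \<le> exp (\<epsilon> - ln (1 - \<beta>) + x\<^sup>2) * q \<sigma>"
    using mixture_mass_ge_crude[OF \<sigma>] beta_less_1 by (simp add: x_def divide_right_mono)
  finally show ?thesis by (simp add: x_def)
qed

text \<open>One bound for all configurations, ready for averaging. Where x^2 > m, the crude bound is
  multiplied by x^2/m > 1 as in Markov's inequality, with the summand 1 absorbing \<epsilon>;
  elsewhere this extra term is nonnegative and harmless.\<close>

lemma ln_curie_weiss_ratio_le:
  assumes \<sigma>: "\<sigma> \<in> spin_configs N" and m4: "4 \<le> m" and eps: "\<epsilon> \<le> 1"
  defines "x \<equiv> rescaled_magnetization N \<sigma>"
  shows "ln (p \<sigma> / q \<sigma>) \<le> 2 * \<epsilon> + a + 4 / m + x\<^sup>2 * (1 - ln (1 - \<beta>) + x\<^sup>2) / m"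
proof -
  note ln_le = ln_divide_le_of_le_exp[OF p_pos q_pos[OF \<sigma>]]
  have L: "ln (1 - \<beta>) \<le> 0" using beta_pos beta_less_1 by simp
  have a0: "0 \<le> a" using beta_pos beta_less_1 by simp
  show ?thesis
  proof (cases "x\<^sup>2 \<le> m")
    case True
    have "0 \<le> x\<^sup>2 * (1 - ln (1 - \<beta>) + x\<^sup>2) / m" using L m4 by (intro divide_nonneg_nonneg mult_nonneg_nonneg) auto
    thus ?thesis using ln_le[OF curie_weiss_le_mixture_typical[OF \<sigma> m4]] True unfolding x_def by linarith
  next
    case False
    have "1 * (1 - ln (1 - \<beta>) + x\<^sup>2) \<le> x\<^sup>2 / m * (1 - ln (1 - \<beta>) + x\<^sup>2)"
      using False m4 L N_pos by (intro mult_right_mono) (auto simp: le_divide_eq)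
    hence "\<epsilon> - ln (1 - \<beta>) + x\<^sup>2 \<le> x\<^sup>2 * (1 - ln (1 - \<beta>) + x\<^sup>2) / m" using eps by simp
    moreover have "0 \<le> 4 / m" using m4 by simp
    ultimately show ?thesis
      using ln_le[OF curie_weiss_le_mixture_crude[OF \<sigma>]] eps_nonneg a0 unfolding x_def by linarith
  qed
qed

section \<open>Moments of the Curie-Weiss magnetization, uniformly in N\<close>

text \<open>The exponential moment is a quotient of partition functions at \<beta> + \<eta> and
  \<beta>, bounded above and below respectively.\<close>

lemma curie_weiss_exp_moment_le:
  assumes "0 < \<eta>" "\<beta> + \<eta> < 1"
  shows "(\<Sum>\<sigma>\<in>spin_configs N. p \<sigma> * exp (\<eta> * (rescaled_magnetization N \<sigma>)\<^sup>2 / 2)) \<le> 1 / sqrt (1 - \<beta> - \<eta>)"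
proof -
  have "cw_weight \<beta> N \<sigma> * exp (\<eta> * (rescaled_magnetization N \<sigma>)\<^sup>2 / 2) = cw_weight (\<beta> + \<eta>) N \<sigma>" for \<sigma>
    by (simp add: cw_weight_eq distrib_right add_divide_distrib flip: exp_add)
  hence "(\<Sum>\<sigma>\<in>spin_configs N. p \<sigma> * exp (\<eta> * (rescaled_magnetization N \<sigma>)\<^sup>2 / 2)) = cw_partition_function (\<beta> + \<eta>) N / Z"
    by (simp add: cw_partition_function_def sum_divide_distrib)
  also have "\<dots> \<le> (2 ^ N / sqrt (1 - (\<beta> + \<eta>))) / 2 ^ N"
    using cw_partition_function_le[of "\<beta> + \<eta>" N] cw_partition_function_ge[of \<beta> N] assms beta_pos N_pos
    by (intro frac_le) (auto simp: field_simps)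
  finally show ?thesis by (simp add: diff_diff_eq)
qed

text \<open>Half of the distance from \<beta> to 1, so that 1 - \<beta> - \<eta> = \<eta>.\<close>

private abbreviation "\<eta> \<equiv> (1 - \<beta>) / 2"
private abbreviation "D \<equiv> (2 / \<eta> * (1 - ln (1 - \<beta>)) + 8 / \<eta>\<^sup>2) / sqrt \<eta>"

text \<open>With y = \<eta> x^2 / 2, the bounds y \<le> exp y and y^2 \<le> 2 exp y dominate the
  polynomial by the exponential moment. The constant \<open>D\<close> does not depend on N.\<close>

lemma curie_weiss_fourth_moment_le:
  "(\<Sum>\<sigma>\<in>spin_configs N. p \<sigma> * ((rescaled_magnetization N \<sigma>)\<^sup>2 *
     (1 - ln (1 - \<beta>) + (rescaled_magnetization N \<sigma>)\<^sup>2))) \<le> D"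
proof -
  define h where "h = \<eta>"
  have h: "0 < h" using beta_less_1 by (simp add: h_def)
  define l where "l = 1 - ln (1 - \<beta>)"
  have "ln (1 - \<beta>) \<le> 0" using beta_pos beta_less_1 by simp
  hence l: "0 \<le> l" by (simp add: l_def)
  have *: "x\<^sup>2 * (l + x\<^sup>2) \<le> (2 / h * l + 8 / h\<^sup>2) * exp (h * x\<^sup>2 / 2)" for x :: real
  proof -
    define y where "y = h * x\<^sup>2 / 2"
    have y: "0 \<le> y" using h by (simp add: y_def)
    have x: "x\<^sup>2 = 2 / h * y" using h by (simp add: y_def)
    have e: "y \<le> exp y" "y\<^sup>2 \<le> 2 * exp y"
      using exp_lower_Taylor_quadratic[OF y] y zero_le_power2[of y] by linarith+
    have "x\<^sup>2 * (l + x\<^sup>2) = 2 / h * l * y + 4 / h\<^sup>2 * y\<^sup>2"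
      unfolding x using h by (simp add: field_simps power2_eq_square)
    also have "\<dots> \<le> 2 / h * l * exp y + 4 / h\<^sup>2 * (2 * exp y)"
      using h l e by (intro add_mono mult_left_mono) auto
    finally show ?thesis by (simp add: y_def algebra_simps)
  qed
  have "(\<Sum>\<sigma>\<in>spin_configs N. p \<sigma> * ((rescaled_magnetization N \<sigma>)\<^sup>2 * (l + (rescaled_magnetization N \<sigma>)\<^sup>2)))
      \<le> (\<Sum>\<sigma>\<in>spin_configs N. p \<sigma> * ((2 / h * l + 8 / h\<^sup>2) * exp (h * (rescaled_magnetization N \<sigma>)\<^sup>2 / 2)))"
    by (intro sum_mono mult_left_mono * less_imp_le[OF p_pos])
  also have "\<dots> = (2 / h * l + 8 / h\<^sup>2) * (\<Sum>\<sigma>\<in>spin_configs N. p \<sigma> * exp (h * (rescaled_magnetization N \<sigma>)\<^sup>2 / 2))"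
    by (simp add: sum_distrib_left mult_ac)
  also have "\<dots> \<le> (2 / h * l + 8 / h\<^sup>2) * (1 / sqrt (1 - \<beta> - h))"
  proof (rule mult_left_mono)
    show "(\<Sum>\<sigma>\<in>spin_configs N. p \<sigma> * exp (h * (rescaled_magnetization N \<sigma>)\<^sup>2 / 2)) \<le> 1 / sqrt (1 - \<beta> - h)"
      using h beta_less_1 by (intro curie_weiss_exp_moment_le) (auto simp: h_def field_simps)
    show "0 \<le> 2 / h * l + 8 / h\<^sup>2" using h l by simp
  qed
  also have "1 - \<beta> - h = h" by (simp add: h_def field_simps)
  finally show ?thesis by (simp add: h_def l_def)
qed

section \<open>Bounds on the two relative entropies\<close>

lemma curie_weiss_eq: "curie_weiss \<beta> N = point_measure (spin_configs N) p"
  by (simp add: curie_weiss_def)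

lemma spin_mixture_eq: "spin_mixture M (truncated_rv X \<delta> N) N = point_measure (spin_configs N) q"
  by (simp add: spin_mixture_def mixture_mass_def)

lemma relative_entropy_mixture_bounds:
  "relative_entropy (spin_mixture M (truncated_rv X \<delta> N) N) (curie_weiss \<beta> N) \<in> {0..ereal (\<epsilon> + a)}"
proof -
  have "(\<Sum>\<sigma>\<in>spin_configs N. q \<sigma> * ln (q \<sigma> / p \<sigma>)) \<le> (\<Sum>\<sigma>\<in>spin_configs N. q \<sigma> * (\<epsilon> + a))"
    by (intro sum_mono mult_left_mono ln_mixture_ratio_le less_imp_le[OF q_pos])
  also have "\<dots> = \<epsilon> + a" by (simp only: sum_q sum_distrib_right[symmetric] mult_1)
  finally show ?thesis
    unfolding curie_weiss_eq spin_mixture_eq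
    using sum_mult_ln_ratio_nonneg[of "spin_configs N" q p] sum_p sum_q
    by (subst relative_entropy_point_measure) (auto simp only: finite_spin_configs p_pos q_pos atLeastAtMost_iff ereal_less_eq zero_ereal_def)
qed

lemma relative_entropy_curie_weiss_bounds:
  assumes m4: "4 \<le> m" and eps: "\<epsilon> \<le> 1"
  shows "relative_entropy (curie_weiss \<beta> N) (spin_mixture M (truncated_rv X \<delta> N) N)
    \<in> {0..ereal (2 * \<epsilon> + a + 4 / m + D / m)}"
proof -
  define f where "f = (\<lambda>\<sigma>. (rescaled_magnetization N \<sigma>)\<^sup>2 * (1 - ln (1 - \<beta>) + (rescaled_magnetization N \<sigma>)\<^sup>2))"
  have "(\<Sum>\<sigma>\<in>spin_configs N. p \<sigma> * ln (p \<sigma> / q \<sigma>)) \<le> (\<Sum>\<sigma>\<in>spin_configs N. p \<sigma> * ((2 * \<epsilon> + a + 4 / m) + f \<sigma> / m))"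
    unfolding f_def by (intro sum_mono mult_left_mono ln_curie_weiss_ratio_le m4 eps less_imp_le[OF p_pos])
  also have "\<dots> = (\<Sum>\<sigma>\<in>spin_configs N. p \<sigma>) * (2 * \<epsilon> + a + 4 / m) + (\<Sum>\<sigma>\<in>spin_configs N. p \<sigma> * f \<sigma>) / m"
    by (simp only: sum_distrib_right sum_divide_distrib sum.distrib[symmetric] distrib_left times_divide_eq_right)
  also have "\<dots> \<le> 1 * (2 * \<epsilon> + a + 4 / m) + D / m"
    unfolding sum_p f_def using m4 by (intro add_left_mono divide_right_mono curie_weiss_fourth_moment_le) auto
  finally show ?thesis
    unfolding curie_weiss_eq spin_mixture_eq mult_1
    using sum_mult_ln_ratio_nonneg[of "spin_configs N" p q] sum_p sum_q
    by (subst relative_entropy_point_measure) (auto simp only: finite_spin_configs p_pos q_pos atLeastAtMost_iff ereal_less_eq zero_ereal_def)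
qed

end

end

section \<open>Passage to the limit\<close>

theorem corollary4p1:
  fixes \<beta> \<delta> :: real and M :: "'w measure" and X :: "'w \<Rightarrow> real"
  assumes "0 < \<beta>" and "\<beta> < 1"
    and "prob_space M"
    and "distributed M lborel X (normal_density 0 (sqrt (\<beta> / (1 - \<beta>))))"
    and "0 < \<delta>" and "\<delta> < 1 / 6"
  shows "((\<lambda>N. relative_entropy (curie_weiss \<beta> N) (spin_mixture M (truncated_rv X \<delta> N) N))
           \<longlonglongrightarrow> 0)
    \<and> ((\<lambda>N. relative_entropy (spin_mixture M (truncated_rv X \<delta> N) N) (curie_weiss \<beta> N))
           \<longlonglongrightarrow> 0)"
proof -
  interpret prob_space M by fact
  interpret gaussian_mixture M X \<beta> \<delta>
    using assms by unfold_locales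
  define m where "m = (\<lambda>N. real N powr \<delta>)"
  define \<epsilon> where "\<epsilon> = (\<lambda>N. m N ^ 3 / sqrt (real N))"
  define a where "a = (\<lambda>N. \<beta> / (1 - \<beta>) / (sqrt (1 - \<beta>) * (m N)\<^sup>2))"
  have m_top: "filterlim m at_top sequentially"
    unfolding m_def using \<open>0 < \<delta>\<close> by real_asymp
  have "m N ^ 3 = real N powr (3 * \<delta>)" for N
    by (simp add: m_def power3_eq_cube flip: powr_add)
  \<comment> \<open>The exponent is negative exactly when \<delta> < 1/6.\<close>
  hence eps_eq: "\<epsilon> = (\<lambda>N. real N powr (3 * \<delta> - 1 / 2))"
    by (simp add: \<epsilon>_def powr_diff powr_half_sqrt)
  have eps_0: "\<epsilon> \<longlonglongrightarrow> 0"
    unfolding eps_eq using \<open>\<delta> < 1 / 6\<close>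
    by (intro tendsto_neg_powr filterlim_real_sequentially) auto
  have inv_0: "(\<lambda>N. K / m N) \<longlonglongrightarrow> 0" for K
    using m_top by (rule real_tendsto_divide_at_top[OF tendsto_const])
  have "(\<lambda>N. \<beta> / (1 - \<beta>) / sqrt (1 - \<beta>) / m N * (1 / m N)) \<longlonglongrightarrow> 0 * 0"
    by (intro tendsto_mult inv_0)
  hence a_0: "a \<longlonglongrightarrow> 0" by (simp add: a_def power2_eq_square mult.assoc)
  have m4: "eventually (\<lambda>N. 4 \<le> m N) sequentially"
    using m_top by (simp add: filterlim_at_top)
  have eps_small: "eventually (\<lambda>N. \<epsilon> N < 1) sequentially"
    using eps_0 by (rule order_tendstoD) simp
  have pos: "eventually (\<lambda>N. 0 < N) sequentially"
    by (rule eventually_gt_at_top)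
  \<comment> \<open>From \<epsilon> < 1 one gets m^3 < sqrt N, and m^2 \<ge> 2 gives 2m \<le>
    m^3.\<close>
  have m_le: "m N \<le> sqrt (real N) / 2" if "4 \<le> m N" "\<epsilon> N < 1" "0 < N" for N
  proof -
    have "m N * 2 \<le> m N * (m N)\<^sup>2"
      using that mult_mono[of 2 "m N" 1 "m N"] by (intro mult_left_mono) (auto simp: power2_eq_square)
    also have "\<dots> \<le> sqrt (real N)"
      using that by (simp add: \<epsilon>_def power3_eq_cube power2_eq_square field_simps)
    finally show ?thesis by simp
  qed
  \<comment> \<open>The constant of \<open>curie_weiss_fourth_moment_le\<close>, written out with
    \<eta> = (1 - \<beta>)/2.\<close>
  define K where "K = (2 / ((1 - \<beta>) / 2) * (1 - ln (1 - \<beta>)) + 8 / ((1 - \<beta>) / 2)\<^sup>2) / sqrt ((1 - \<beta>) / 2)"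
  have bounds: "eventually (\<lambda>N. relative_entropy (curie_weiss \<beta> N) (spin_mixture M (truncated_rv X \<delta> N) N)
      \<in> {0..ereal (2 * \<epsilon> N + a N + 4 / m N + K / m N)}
    \<and> relative_entropy (spin_mixture M (truncated_rv X \<delta> N) N) (curie_weiss \<beta> N) \<in> {0..ereal (\<epsilon> N + a N)}) sequentially"
    using m4 eps_small pos
  proof eventually_elim
    case (elim N)
    have "real N powr \<delta> \<le> sqrt (real N) / 2" using m_le[OF elim] by (simp add: m_def)
    from relative_entropy_curie_weiss_bounds[OF elim(3) this] relative_entropy_mixture_bounds[OF elim(3) this] elim
    show ?case unfolding \<epsilon>_def a_def m_def K_def by simp
  qed
  have lim1: "(\<lambda>N. ereal (2 * \<epsilon> N + a N + 4 / m N + K / m N)) \<longlonglongrightarrow> 0"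
    using tendsto_ereal[OF tendsto_add[OF tendsto_add[OF tendsto_add[OF
      tendsto_mult[OF tendsto_const[of 2] eps_0] a_0] inv_0[of 4]] inv_0[of K]]]
    by (simp add: zero_ereal_def)
  have lim2: "(\<lambda>N. ereal (\<epsilon> N + a N)) \<longlonglongrightarrow> 0"
    using tendsto_ereal[OF tendsto_add[OF eps_0 a_0]] by (simp add: zero_ereal_def)
  show ?thesis
  proof
    show "(\<lambda>N. relative_entropy (curie_weiss \<beta> N) (spin_mixture M (truncated_rv X \<delta> N) N)) \<longlonglongrightarrow> 0"
      by (rule tendsto_sandwich[OF _ _ tendsto_const lim1]) (use bounds in \<open>auto elim: eventually_mono\<close>)
    show "(\<lambda>N. relative_entropy (spin_mixture M (truncated_rv X \<delta> N) N) (curie_weiss \<beta> N)) \<longlonglongrightarrow> 0"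
      by (rule tendsto_sandwich[OF _ _ tendsto_const lim2]) (use bounds in \<open>auto elim: eventually_mono\<close>)
  qed
qed

end
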